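(* Let $G$ be a finite abstract simplicial complex and let $h: G\to\mathbb{R}$ be any function. The number of negative eigenvalues (counted with multiplicity) of the real symmetric matrix $L=L^{--}$ is equal to the number of elements $x\in G$ with $h(x)<0$. The same is true for the matrix $L^{++}$ and for the matrix $g=SL^{++}S$.
   Context: A finite abstract simplicial complex $G$ is a finite set of finite non-empty sets closed under the operation of taking non-empty subsets. For $x\in G$ let $W^+(x)=\{y\in G: x\subset y\}$ and $W^-(x)=\{y\in G: y\subset x\}$ (both include $x$). Let $|x|$ be the cardinality of $x$, $\dim(x)=|x|-1$ and $\omega(x)=(-1)^{\dim(x)}$. For a function $h$ on $G$ and $A\subset G$ put $E[A]=\sum_{x\in A}h(x)$ (with $E[\emptyset]=0$). The matrices, indexed by $G\times G$, are $L^{--}(x,y)=E[W^-(x)\cap W^-(y)]$, $L^{++}(x,y)=E[W^+(x)\cap W^+(y)]$, and $S(x,y)=\omega(x)$ if $x=y$ and $0$ otherwise. Set $L=L^{--}$ and $g=SL^{++}S$. *)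

theory Defs
  imports Jordan_Normal_Form.Char_Poly
begin

definition simplicial_complex :: "'a set set \<Rightarrow> bool" where
  "simplicial_complex G \<longleftrightarrow>
     finite G \<and> (\<forall>x\<in>G. finite x \<and> x \<noteq> {}) \<and>
     (\<forall>x\<in>G. \<forall>y. y \<subseteq> x \<longrightarrow> y \<noteq> {} \<longrightarrow> y \<in> G)"

definition star :: "'a set set \<Rightarrow> 'a set \<Rightarrow> 'a set set" where
  "star G x = {y \<in> G. x \<subseteq> y}"

definition core :: "'a set set \<Rightarrow> 'a set \<Rightarrow> 'a set set" where
  "core G x = {y \<in> G. y \<subseteq> x}"

definition simplex_dim :: "'a set \<Rightarrow> int" where
  "simplex_dim x = int (card x) - 1"

definition omega :: "'a set \<Rightarrow> real" where
  "omega x = (-1) powi simplex_dim x"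

definition energy :: "('a set \<Rightarrow> real) \<Rightarrow> 'a set set \<Rightarrow> real" where
  "energy h A = (\<Sum>x\<in>A. h x)"

text \<open>A matrix indexed by a finite set is represented by means of a list \<open>xs\<close> that
  enumerates this set without repetition.\<close>

definition mat_of_kernel :: "'b list \<Rightarrow> ('b \<Rightarrow> 'b \<Rightarrow> real) \<Rightarrow> real mat" where
  "mat_of_kernel xs K = mat (length xs) (length xs) (\<lambda>(i, j). K (xs ! i) (xs ! j))"

definition L_minus :: "'a set list \<Rightarrow> ('a set \<Rightarrow> real) \<Rightarrow> real mat" where
  "L_minus xs h =
     mat_of_kernel xs (\<lambda>x y. energy h (core (set xs) x \<inter> core (set xs) y))"

definition L_plus :: "'a set list \<Rightarrow> ('a set \<Rightarrow> real) \<Rightarrow> real mat" where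
  "L_plus xs h =
     mat_of_kernel xs (\<lambda>x y. energy h (star (set xs) x \<inter> star (set xs) y))"

definition S_mat :: "'a set list \<Rightarrow> real mat" where
  "S_mat xs = mat_of_kernel xs (\<lambda>x y. if x = y then omega x else 0)"

definition g_mat :: "'a set list \<Rightarrow> ('a set \<Rightarrow> real) \<Rightarrow> real mat" where
  "g_mat xs h = S_mat xs * L_plus xs h * S_mat xs"

text \<open>The multiplicity of an eigenvalue is its algebraic multiplicity; for the real symmetric
  matrices considered here it coincides with the geometric one, and all eigenvalues are real.\<close>

definition num_neg_eigenvalues :: "real mat \<Rightarrow> nat" where
  "num_neg_eigenvalues A = (\<Sum>e | eigenvalue A e \<and> e < 0. order e (char_poly A))"

end

theory Submission
  imports Defs "Jordan_Normal_Form.Schur_Decomposition"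
begin

text \<open>All three matrices are congruent to the diagonal matrix \<open>D\<close> with entries \<open>h x\<close>, so the result
  is an instance of Sylvester's law of inertia. Let \<open>Z\<close> be the zeta matrix of the inclusion order,
  \<open>Z(z,x) = 1\<close> if \<open>z \<subseteq> x\<close> and \<open>0\<close> otherwise. The simplices contained in both \<open>x\<close> and \<open>y\<close> are exactly
  those \<open>z\<close> with \<open>Z(z,x) Z(z,y) = 1\<close>, whence \<open>L\<^sup>-\<^sup>- = Z\<^sup>T D Z\<close>; dually \<open>L\<^sup>+\<^sup>+ = Z D Z\<^sup>T\<close>, and therefore
  \<open>g = (Z\<^sup>T S)\<^sup>T D (Z\<^sup>T S)\<close> (lemmas \<open>L_minus_congruence\<close>, \<open>L_plus_congruence\<close>). The matrix \<open>Z\<close> is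
  invertible because it is unitriangular once the simplices are sorted by size
  (\<open>det_zeta_mat_nonzero\<close>), and \<open>S\<close> is its own inverse.

  The law of inertia (\<open>sylvester_inertia_negative\<close>) relates \<open>D\<close> to the eigenvalues of a congruent
  matrix \<open>A\<close>. The spectral theorem provides an orthogonal \<open>P\<close> such that \<open>P\<^sup>T A P\<close> is diagonal; since
  \<open>P\<^sup>T = P\<^sup>-\<^sup>1\<close>, its entries are the eigenvalues of \<open>A\<close> with multiplicity. So there are two congruent
  diagonal matrices, and it remains to see that congruent diagonal matrices have the same number of
  negative entries. By symmetry one inequality is enough, and it is a dimension count
  (\<open>congruent_diagonal_negative_entries_le\<close>): otherwise a nonzero vector would exist on which the
  common quadratic form is both negative and nonnegative.\<close>

section \<open>The spectral theorem for real symmetric matrices\<close>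

text \<open>The characteristic polynomial has a complex root \<open>z\<close>. If \<open>v\<close> is a complex eigenvector for \<open>z\<close>,
  then moving the real symmetric \<open>A\<close> from one argument of the Hermitian product of \<open>v\<close> with itself to
  the other gives \<open>z = cnj z\<close>.\<close>

lemma symmetric_real_mat_has_eigenvalue:
  fixes A :: "real mat"
  assumes A: "A \<in> carrier_mat n n" and sym: "transpose_mat A = A" and n: "n \<noteq> 0"
  obtains e where "eigenvalue A e"
proof -
  define C where "C = map_mat complex_of_real A"
  have C: "C \<in> carrier_mat n n" using A by (simp add: C_def)
  have "degree (char_poly C) > 0" using degree_monic_char_poly[OF C] n by simp
  then have "\<not> constant (poly (char_poly C))" by (simp add: constant_degree)
  from fundamental_theorem_of_algebra[OF this] obtain z where "poly (char_poly C) z = 0" by auto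
  then have "eigenvalue C z" by (simp add: eigenvalue_root_char_poly[OF C])
  then obtain v where v: "v \<in> carrier_vec n" "v \<noteq> 0\<^sub>v n" and Cv: "C *\<^sub>v v = z \<cdot>\<^sub>v v"
    using C unfolding eigenvalue_def eigenvector_def by auto
  have real_entries: "conjugate (C *\<^sub>v v) = C *\<^sub>v conjugate v"
    using A v(1) by (intro eq_vecI) (auto simp: C_def scalar_prod_def)
  have sym': "transpose_mat C = C"
  proof -
    have "transpose_mat C = map_mat complex_of_real (transpose_mat A)"
      unfolding C_def by (intro eq_matI) auto
    then show ?thesis by (simp add: sym C_def)
  qed
  have "z * (v \<bullet>c v) = (C *\<^sub>v v) \<bullet>c v" using v by (simp add: Cv)
  also have "\<dots> = v \<bullet> (C *\<^sub>v conjugate v)"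
    using transpose_vec_mult_scalar[OF C, of "conjugate v" v] v(1) sym' by simp
  also have "\<dots> = v \<bullet>c (z \<cdot>\<^sub>v v)" using real_entries Cv by simp
  also have "\<dots> = cnj z * (v \<bullet>c v)" using v(1) by (simp add: scalar_prod_def sum_distrib_left ac_simps)
  finally have "z = cnj z" using v by auto
  then have z: "z = of_real (Re z)" by (metis Reals_cnj_iff of_real_Re)
  have "of_real (poly (char_poly A) (Re z)) = poly (char_poly C) z"
    unfolding C_def of_real_hom.char_poly_hom[OF A] by (subst z) simp
  then have "poly (char_poly A) (Re z) = 0" using \<open>poly (char_poly C) z = 0\<close> by simp
  then show thesis using that by (simp add: eigenvalue_root_char_poly[OF A])
qed

lemma transpose_congruence_symmetric:
  fixes A :: "'a :: comm_semiring_0 mat"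
  assumes "A \<in> carrier_mat n n" "transpose_mat A = A" "M \<in> carrier_mat n n"
  shows "transpose_mat (transpose_mat M * A * M) = transpose_mat M * A * M"
  using assms by (simp add: transpose_mult[of _ n n _ n] assoc_mult_mat[of _ n n _ n _ n])

lemma congruence_compose:
  fixes A :: "'a :: comm_semiring_0 mat"
  assumes "A \<in> carrier_mat n n" "M \<in> carrier_mat n n" "N \<in> carrier_mat n n"
  shows "transpose_mat (M * N) * A * (M * N) = transpose_mat N * (transpose_mat M * A * M) * N"
  using assms by (simp add: transpose_mult[of _ n n _ n] assoc_mult_mat[of _ n n _ n _ n])

text \<open>Extend \<open>v\<close> to a basis, apply the Gram-Schmidt process, which keeps the first vector, and
  normalize.\<close>

lemma orthogonal_mat_with_first_col:
  fixes v :: "real vec"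
  assumes v: "v \<in> carrier_vec n" "v \<noteq> 0\<^sub>v n"
  obtains W c where "W \<in> carrier_mat n n" "transpose_mat W * W = 1\<^sub>m n" "col W 0 = c \<cdot>\<^sub>v v"
proof -
  interpret cof_vec_space n "TYPE(real)" .
  define ws where "ws = gram_schmidt n (basis_completion v)"
  note b = basis_completion[OF v]
  note gs = gram_schmidt_result[OF b(2,4,5) refl, folded ws_def]
  have len: "length ws = n" using gs(4) b(6) by simp
  have n: "n \<noteq> 0" using v by auto
  then obtain vs where "basis_completion v = v # vs" using b(6,7) by (cases "basis_completion v") auto
  then have hd: "ws ! 0 = v"
    using gram_schmidt_hd[OF v(1), of vs] len n by (metis hd_conv_nth length_0_conv ws_def)
  have carr: "ws ! i \<in> carrier_vec n" if "i < n" for i using gs(3) len that by auto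
  define u where "u i = (1 / sqrt (ws ! i \<bullet> ws ! i)) \<cdot>\<^sub>v ws ! i" for i
  have u: "u i \<in> carrier_vec n" if "i < n" for i using carr[OF that] by (simp add: u_def)
  have conj: "conjugate w = w" for w :: "real vec" by (intro eq_vecI) auto
  have orth: "u i \<bullet> u j = (if i = j then 1 else 0)" if ij: "i < n" "j < n" for i j
  proof -
    have "(ws ! i \<bullet> ws ! j = 0) = (i \<noteq> j)"
      using corthogonalD[OF gs(2), of i j] ij len by (simp add: conj)
    moreover have "ws ! i \<bullet> ws ! i \<ge> 0"
      using conjugate_square_ge_0_vec[of "ws ! i"] by (simp add: conj)
    moreover have "u i \<bullet> u j = (1 / sqrt (ws ! i \<bullet> ws ! i)) * (1 / sqrt (ws ! j \<bullet> ws ! j)) * (ws ! i \<bullet> ws ! j)"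
      using carr[OF ij(1)] carr[OF ij(2)] by (simp add: u_def)
    ultimately show ?thesis by auto
  qed
  define W where "W = mat_of_cols n (map u [0..<n])"
  have W: "W \<in> carrier_mat n n" by (intro carrier_matI) (simp_all add: W_def)
  have col: "col W i = u i" if "i < n" for i
    using that u by (simp add: W_def)
  have "transpose_mat W * W = 1\<^sub>m n"
    using W by (intro eq_matI) (auto simp: col orth)
  moreover have "col W 0 = (1 / sqrt (v \<bullet> v)) \<cdot>\<^sub>v v" using n col[of 0] by (simp add: u_def hd)
  ultimately show thesis using W that by blast
qed

text \<open>Deflation: in an orthonormal basis whose first vector is an eigenvector for \<open>e\<close>, the first
  column of the matrix is \<open>(e, 0, \<dots>, 0)\<close>. Orthogonal changes of basis preserve symmetry, so the first
  row has the same form, and the induction hypothesis applies to the remaining block.\<close>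

lemma spectral_theorem_real_symmetric:
  fixes A :: "real mat"
  assumes "A \<in> carrier_mat n n" "transpose_mat A = A"
  shows "\<exists>P d. P \<in> carrier_mat n n \<and> transpose_mat P * P = 1\<^sub>m n \<and>
    transpose_mat P * A * P = mat_diag n d"
  using assms
proof (induction n arbitrary: A)
  case 0
  then show ?case by (intro exI[of _ "1\<^sub>m 0"] exI[of _ "\<lambda>_. 0"]) (auto intro!: eq_matI simp: mat_diag_def)
next
  case (Suc m)
  note A = Suc.prems(1)
  obtain e where "eigenvalue A e"
    using symmetric_real_mat_has_eigenvalue[OF Suc.prems] by auto
  then obtain v where v: "v \<in> carrier_vec (Suc m)" "v \<noteq> 0\<^sub>v (Suc m)" and Av: "A *\<^sub>v v = e \<cdot>\<^sub>v v"
    using A unfolding eigenvalue_def eigenvector_def by auto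
  obtain W c where W: "W \<in> carrier_mat (Suc m) (Suc m)" and WW: "transpose_mat W * W = 1\<^sub>m (Suc m)"
    and W0: "col W 0 = c \<cdot>\<^sub>v v"
    using orthogonal_mat_with_first_col[OF v] by blast
  define B where "B = transpose_mat W * A * W"
  have B: "B \<in> carrier_mat (Suc m) (Suc m)" using A W by (simp add: B_def)
  have Bsym: "transpose_mat B = B"
    unfolding B_def by (rule transpose_congruence_symmetric[OF Suc.prems W])
  have Bij: "B $$ (i,j) = B $$ (j,i)" if "i < Suc m" "j < Suc m" for i j
    using arg_cong[OF Bsym, of "\<lambda>M. M $$ (i,j)"] B that by simp
  have AW0: "A *\<^sub>v col W 0 = e \<cdot>\<^sub>v col W 0"
    using A v by (simp add: W0 mult_mat_vec Av smult_smult_assoc mult.commute)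
  have B0: "B $$ (i,0) = (if i = 0 then e else 0)" if i: "i < Suc m" for i
  proof -
    have "B $$ (i,0) = (transpose_mat W * (A * W)) $$ (i,0)"
      using A W by (simp add: B_def)
    also have "\<dots> = col W i \<bullet> col (A * W) 0" using A W i by simp
    also have "col (A * W) 0 = A *\<^sub>v col W 0" using A W by (intro col_mult2) auto
    also have "col W i \<bullet> (A *\<^sub>v col W 0) = e * (col W i \<bullet> col W 0)" unfolding AW0 using W i by simp
    also have "col W i \<bullet> col W 0 = (transpose_mat W * W) $$ (i,0)" using W i by simp
    finally show ?thesis using i by (simp add: WW)
  qed
  define A' where "A' = mat m m (\<lambda>(i,j). B $$ (Suc i, Suc j))"
  have A': "A' \<in> carrier_mat m m" by (simp add: A'_def)
  have "transpose_mat A' = A'" by (intro eq_matI) (auto simp: A'_def intro: Bij)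
  from Suc.IH[OF A' this] obtain U d where U: "U \<in> carrier_mat m m"
    and UU: "transpose_mat U * U = 1\<^sub>m m" and UAU: "transpose_mat U * A' * U = mat_diag m d" by blast
  define E where "E = mat 1 1 (\<lambda>_. e)"
  have E: "E \<in> carrier_mat 1 1" by (simp add: E_def)
  have B_block: "B = four_block_mat E (0\<^sub>m 1 m) (0\<^sub>m m 1) A'"
  proof (rule eq_matI)
    fix i j assume "i < dim_row (four_block_mat E (0\<^sub>m 1 m) (0\<^sub>m m 1) A')"
      "j < dim_col (four_block_mat E (0\<^sub>m 1 m) (0\<^sub>m m 1) A')"
    then have ij: "i < Suc m" "j < Suc m" using E A' by auto
    then show "B $$ (i, j) = four_block_mat E (0\<^sub>m 1 m) (0\<^sub>m m 1) A' $$ (i, j)"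
      using B0[OF ij(1)] B0[OF ij(2)] Bij[OF ij]
      by (cases i; cases j) (auto simp: E_def A'_def)
  qed (use B A' E in auto)
  define R where "R = four_block_mat (1\<^sub>m 1) (0\<^sub>m 1 m) (0\<^sub>m m 1) U"
  have R: "R \<in> carrier_mat (Suc m) (Suc m)"
    using four_block_carrier_mat[of "1\<^sub>m 1" 1 1 U m m] U by (simp add: R_def)
  have RT: "transpose_mat R = four_block_mat (1\<^sub>m 1) (0\<^sub>m 1 m) (0\<^sub>m m 1) (transpose_mat U)"
    unfolding R_def by (subst transpose_four_block_mat[OF _ _ _ U]) auto
  have RR: "transpose_mat R * R = 1\<^sub>m (Suc m)"
    unfolding RT unfolding R_def
    by (subst mult_four_block_mat[of _ 1 1 _ m _ m _ _ 1 _ m]) (use U UU in auto)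
  have "transpose_mat R * B = four_block_mat E (0\<^sub>m 1 m) (0\<^sub>m m 1) (transpose_mat U * A')"
    unfolding RT B_block
    by (subst mult_four_block_mat[of _ 1 1 _ m _ m _ _ 1 _ m]) (use U A' E in auto)
  then have "transpose_mat R * B * R = four_block_mat E (0\<^sub>m 1 m) (0\<^sub>m m 1) (mat_diag m d)"
    unfolding R_def
    by (simp, subst mult_four_block_mat[of _ 1 1 _ m _ m _ _ 1 _ m]) (use U A' E UAU in auto)
  also have "\<dots> = mat_diag (Suc m) (case_nat e d)"
    by (intro eq_matI) (auto simp: E_def mat_diag_def split: nat.splits)
  finally have RBR: "transpose_mat R * B * R = mat_diag (Suc m) (case_nat e d)" .
  note assoc = assoc_mult_mat[of _ "Suc m" "Suc m" _ "Suc m" _ "Suc m"]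
  have T: "transpose_mat (W * R) = transpose_mat R * transpose_mat W"
    using W R by (simp add: transpose_mult)
  have "transpose_mat (W * R) * (W * R) = transpose_mat R * ((transpose_mat W * W) * R)"
    using W R by (simp add: T assoc)
  then have "transpose_mat (W * R) * (W * R) = 1\<^sub>m (Suc m)" using R by (simp add: WW RR)
  moreover have "transpose_mat (W * R) * A * (W * R) = transpose_mat R * B * R"
    unfolding B_def by (rule congruence_compose[OF A W R])
  ultimately show ?case using W R RBR by (intro exI[of _ "W * R"] exI[of _ "case_nat e d"]) simp
qed


section \<open>Sylvester's law of inertia\<close>

text \<open>Padding the rows with zeros yields a square matrix that is singular because its transpose
  annihilates the last unit vector.\<close>

lemma underdetermined_system_has_nonzero_solution:
  fixes rs :: "'a :: field vec list"
  assumes rs: "set rs \<subseteq> carrier_vec n" and len: "length rs < n"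
  obtains w where "w \<in> carrier_vec n" "w \<noteq> 0\<^sub>v n" "\<And>r. r \<in> set rs \<Longrightarrow> r \<bullet> w = 0"
proof -
  define M where "M = mat_of_rows n (rs @ replicate (n - length rs) (0\<^sub>v n))"
  have M: "M \<in> carrier_mat n n" using len unfolding M_def by (intro carrier_matI) auto
  have row_M: "row M i = (if i < length rs then rs ! i else 0\<^sub>v n)" if "i < n" for i
    unfolding M_def using that rs len
    by (subst mat_of_rows_row) (auto simp: nth_append)
  have "col (transpose_mat M) (n - 1) = 0\<^sub>v n"
    using row_M[of "n - 1"] len M by (auto simp del: One_nat_def)
  moreover have "transpose_mat M *\<^sub>v unit_vec n (n - 1) = col (transpose_mat M) (n - 1)"
    using M len by (intro eq_vecI) auto
  ultimately have "det (transpose_mat M) = 0"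
    using det_0_iff_vec_prod_zero[of "transpose_mat M" n] M len
    by (metis unit_vec_carrier unit_vec_nonzero diff_less less_nat_zero_code less_one linorder_neqE_nat transpose_carrier_mat)
  then obtain w where w: "w \<in> carrier_vec n" "w \<noteq> 0\<^sub>v n" "M *\<^sub>v w = 0\<^sub>v n"
    using det_0_iff_vec_prod_zero[OF M] det_transpose[OF M] by auto
  have "r \<bullet> w = 0" if r: "r \<in> set rs" for r
  proof -
    obtain i where i: "i < length rs" "r = rs ! i" using r by (auto simp: in_set_conv_nth)
    then have "r \<bullet> w = (M *\<^sub>v w) $ i" using row_M[of i] len M by simp
    then show ?thesis using w(3) i len by simp
  qed
  then show thesis using w that by blast
qed

lemma mat_diag_quadratic_form:
  fixes x :: "real vec"
  assumes "x \<in> carrier_vec n"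
  shows "x \<bullet> (mat_diag n d *\<^sub>v x) = (\<Sum>i<n. d i * (x $ i)\<^sup>2)"
proof -
  have "(mat_diag n d *\<^sub>v x) $ i = d i * x $ i" if "i < n" for i
  proof -
    have "(mat_diag n d *\<^sub>v x) $ i = (\<Sum>j\<in>{0..<n}. (if i = j then d j else 0) * x $ j)"
      using assms that by (auto simp: mat_diag_def scalar_prod_def)
    also have "\<dots> = (\<Sum>j\<in>{0..<n}. if i = j then d j * x $ j else 0)"
      by (rule sum.cong) auto
    finally show ?thesis using that by simp
  qed
  moreover have "dim_vec (mat_diag n d *\<^sub>v x) = n" by (simp add: mat_diag_def)
  ultimately show ?thesis
    by (simp add: scalar_prod_def power2_eq_square lessThan_atLeast0 mult.left_commute)
qed

text \<open>Ask of \<open>w\<close> that it be supported on the indices with \<open>e i < 0\<close> and that \<open>Q w\<close> vanish at the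
  indices with \<open>d i < 0\<close>. If the claim failed, these would be fewer than \<open>n\<close> linear equations, so a
  nonzero solution would exist. For it the form of \<open>e\<close> at \<open>w\<close> is negative, whereas the form of \<open>d\<close> at
  \<open>Q w\<close>, which has the same value, is nonnegative. As \<open>Q\<close> is arbitrary, the two directions of the law
  of inertia are both instances.\<close>

lemma congruent_diagonal_negative_entries_le:
  fixes Q :: "real mat"
  assumes Q: "Q \<in> carrier_mat m n"
    and eq: "mat_diag n e = transpose_mat Q * mat_diag m d * Q"
  shows "card {i. i < n \<and> e i < 0} \<le> card {i. i < m \<and> d i < 0}"
proof (rule ccontr)
  assume *: "\<not> ?thesis"
  define rs where "rs = map (unit_vec n) (filter (\<lambda>i. \<not> e i < 0) [0..<n])
    @ map (row Q) (filter (\<lambda>i. d i < 0) [0..<m])"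
  have count: "length (filter P [0..<k]) = card {i. i < k \<and> P i}" for P and k :: nat
    by (simp add: length_filter_conv_card conj_commute cong: conj_cong)
  have "card {i. i < n \<and> \<not> e i < 0} + card {i. i < n \<and> e i < 0} = n"
    using sum_length_filter_compl[of "\<lambda>i. e i < 0" "[0..<n]"] by (simp add: count)
  then have len: "length rs < n" using * by (simp add: rs_def count)
  have "set rs \<subseteq> carrier_vec n" using Q by (auto simp: rs_def)
  from underdetermined_system_has_nonzero_solution[OF this len]
  obtain w where w: "w \<in> carrier_vec n" "w \<noteq> 0\<^sub>v n" and orth: "\<And>r. r \<in> set rs \<Longrightarrow> r \<bullet> w = 0"
    by blast
  have w0: "w $ i = 0" if "i < n" "\<not> e i < 0" for i
    using orth[of "unit_vec n i"] that w(1) by (simp add: rs_def)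
  have Qw0: "(Q *\<^sub>v w) $ i = 0" if "i < m" "d i < 0" for i
    using orth[of "row Q i"] that Q by (simp add: rs_def)
  have y: "Q *\<^sub>v w \<in> carrier_vec m" using Q w by simp
  have "w \<bullet> (mat_diag n e *\<^sub>v w) = w \<bullet> (transpose_mat Q *\<^sub>v (mat_diag m d *\<^sub>v (Q *\<^sub>v w)))"
    unfolding eq using Q w(1)
    by (simp add: assoc_mult_mat_vec[of _ n m _ n] assoc_mult_mat_vec[of _ n m _ m])
  also have "\<dots> = (Q *\<^sub>v w) \<bullet> (mat_diag m d *\<^sub>v (Q *\<^sub>v w))"
    using transpose_vec_mult_scalar[OF Q w(1), of "mat_diag m d *\<^sub>v (Q *\<^sub>v w)"] y Q w(1)
    by (metis comm_scalar_prod mat_diag_dim mult_mat_vec_carrier transpose_carrier_mat)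
  also have "\<dots> = (\<Sum>i<m. d i * ((Q *\<^sub>v w) $ i)\<^sup>2)" by (rule mat_diag_quadratic_form[OF y])
  also have "\<dots> \<ge> 0"
  proof (rule sum_nonneg)
    fix i assume "i \<in> {..<m}"
    then show "0 \<le> d i * ((Q *\<^sub>v w) $ i)\<^sup>2" using Qw0[of i] by (cases "d i < 0") auto
  qed
  finally have nonneg: "(\<Sum>i<n. e i * (w $ i)\<^sup>2) \<ge> 0" by (simp add: mat_diag_quadratic_form[OF w(1)])
  obtain k where k: "k < n" "w $ k \<noteq> 0"
    using w by (metis carrier_vecD eq_vecI index_zero_vec)
  have "(\<Sum>i<n. e i * (w $ i)\<^sup>2) < (\<Sum>i<n. 0)"
  proof (rule sum_strict_mono_ex1)
    show "\<forall>i\<in>{..<n}. e i * (w $ i)\<^sup>2 \<le> 0"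
      using w0 by (metis lessThan_iff less_imp_le mult_nonpos_nonneg mult_zero_right power_zero_numeral zero_le_power2)
    show "\<exists>i\<in>{..<n}. e i * (w $ i)\<^sup>2 < 0"
      using k w0[of k] by (intro bexI[of _ k]) (auto simp: mult_less_0_iff)
  qed simp
  then show False using nonneg by simp
qed

lemma order_prod_list_linear:
  fixes as :: "'a :: field list"
  shows "Polynomial.order x (\<Prod>a\<leftarrow>as. [:- a, 1:]) = count_list as x"
proof (induction as)
  case (Cons a as)
  have nz: "[:- a, 1:] * (\<Prod>a\<leftarrow>as. [:- a, 1:]) \<noteq> 0"
    by (auto simp: prod_list_zero_iff simp del: mult_pCons_left)
  have "Polynomial.order x ([:- a, 1:] * (\<Prod>a\<leftarrow>as. [:- a, 1:])) = Polynomial.order x [:- a, 1:] + count_list as x"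
    using nz by (subst order_mult) (simp_all add: Cons.IH del: mult_pCons_left)
  moreover have "Polynomial.order x [:- a, 1:] = (if a = x then 1 else 0)"
    using order_power_n_n[of a 1] by (auto simp: order_root order_0I)
  ultimately show ?case by simp
qed (simp add: order_0I)

text \<open>For orthogonal \<open>P\<close> congruence is similarity, so the characteristic polynomial splits into the
  factors \<open>X - e i\<close>, and the algebraic multiplicity of an eigenvalue counts its occurrences among the
  \<open>e i\<close>.\<close>

lemma num_neg_eigenvalues_orthogonally_diagonalized:
  assumes A: "A \<in> carrier_mat n n" and P: "P \<in> carrier_mat n n" "transpose_mat P * P = 1\<^sub>m n"
    and PAP: "transpose_mat P * A * P = mat_diag n e"
  shows "num_neg_eigenvalues A = card {i. i < n \<and> e i < 0}"
proof -
  define es where "es = map e [0..<n]"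
  have "P * transpose_mat P = 1\<^sub>m n"
    using mat_mult_left_right_inverse[OF _ P(1) P(2)] P(1) by simp
  then have "similar_mat_wit (mat_diag n e) A (transpose_mat P) P"
    using A P PAP by (intro similar_mat_witI[of _ _ n]) auto
  then have "char_poly (mat_diag n e) = char_poly A"
    by (intro char_poly_similar) (auto simp: similar_mat_def)
  moreover have "char_poly (mat_diag n e) = (\<Prod>a\<leftarrow>es. [:- a, 1:])"
  proof -
    have "diag_mat (mat_diag n e) = es" by (auto simp: diag_mat_def mat_diag_def es_def)
    moreover have "upper_triangular (mat_diag n e)"
      by (auto simp: upper_triangular_def mat_diag_def)
    ultimately show ?thesis
      using char_poly_upper_triangular[OF mat_diag_dim] by metis
  qed
  ultimately have cp: "char_poly A = (\<Prod>a\<leftarrow>es. [:- a, 1:])" by simp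
  have ev: "eigenvalue A x \<longleftrightarrow> x \<in> set es" for x
    unfolding eigenvalue_root_char_poly[OF A] cp by (induction es) auto
  have "num_neg_eigenvalues A = (\<Sum>x | x \<in> set es \<and> x < 0. count_list es x)"
    by (simp add: num_neg_eigenvalues_def ev cp order_prod_list_linear)
  also have "\<dots> = (\<Sum>x\<in>set (filter (\<lambda>a. a < 0) es). count_list (filter (\<lambda>a. a < 0) es) x)"
  proof (rule sum.cong)
    fix x assume "x \<in> set (filter (\<lambda>a. a < 0) es)"
    then have "x < 0" by simp
    then show "count_list es x = count_list (filter (\<lambda>a. a < 0) es) x"
      by (induction es) auto
  qed auto
  also have "\<dots> = length (filter (\<lambda>a. a < 0) es)" by (rule sum_count_set) auto
  also have "\<dots> = card {i. i < n \<and> e i < 0}"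
    by (simp add: es_def length_filter_conv_card cong: conj_cong)
  finally show ?thesis .
qed

theorem sylvester_inertia_negative:
  fixes M :: "real mat"
  assumes M: "M \<in> carrier_mat n n" and inv: "det M \<noteq> 0"
  shows "num_neg_eigenvalues (transpose_mat M * mat_diag n d * M) = card {i. i < n \<and> d i < 0}"
proof -
  define A where "A = transpose_mat M * mat_diag n d * M"
  have D: "mat_diag n d \<in> carrier_mat n n" "transpose_mat (mat_diag n d) = mat_diag n d"
    by (simp, intro eq_matI) (auto simp: mat_diag_def)
  have A: "A \<in> carrier_mat n n" using M D unfolding A_def by (meson mult_carrier_mat transpose_carrier_mat)
  have "transpose_mat A = A"
    unfolding A_def by (rule transpose_congruence_symmetric[OF D M])
  from spectral_theorem_real_symmetric[OF A this] obtain P e where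
    P: "P \<in> carrier_mat n n" and PP: "transpose_mat P * P = 1\<^sub>m n"
    and PAP: "transpose_mat P * A * P = mat_diag n e" by blast
  have PP': "P * transpose_mat P = 1\<^sub>m n"
    using mat_mult_left_right_inverse[OF _ P PP] P by simp
  obtain N where N: "N \<in> carrier_mat n n" and MN: "M * N = 1\<^sub>m n"
    using det_non_zero_imp_unit[OF M inv, of undefined] by (auto simp: Units_def ring_mat_def)
  \<comment> \<open>With the eigenvalues \<open>e\<close> of \<open>A\<close>, the two diagonal matrices are congruent by way of \<open>M P\<close>
    and, in the other direction, its inverse \<open>P\<^sup>T N\<close>.\<close>
  have le: "card {i. i < n \<and> e i < 0} \<le> card {i. i < n \<and> d i < 0}"
  proof (rule congruent_diagonal_negative_entries_le)
    show "M * P \<in> carrier_mat n n" using M P by simp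
    show "mat_diag n e = transpose_mat (M * P) * mat_diag n d * (M * P)"
      using congruence_compose[OF D(1) M P] PAP by (simp add: A_def)
  qed
  have ge: "card {i. i < n \<and> d i < 0} \<le> card {i. i < n \<and> e i < 0}"
  proof (rule congruent_diagonal_negative_entries_le)
    show "transpose_mat P * N \<in> carrier_mat n n" using N P by simp
    have PT: "transpose_mat P \<in> carrier_mat n n" using P by simp
    have "transpose_mat (transpose_mat P * N) * mat_diag n e * (transpose_mat P * N)
      = transpose_mat N * (P * (transpose_mat P * A * P) * transpose_mat P) * N"
      using congruence_compose[OF mat_diag_dim PT N, of e] by (simp add: PAP)
    also have "P * (transpose_mat P * A * P) * transpose_mat P = A"
      using congruence_compose[OF A P PT] A by (simp add: PP')
    also have "transpose_mat N * A * N = mat_diag n d"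
      using congruence_compose[OF D(1) M N] D(1) by (simp add: A_def MN)
    finally show "mat_diag n d = transpose_mat (transpose_mat P * N) * mat_diag n e * (transpose_mat P * N)"
      by simp
  qed
  show ?thesis
    using num_neg_eigenvalues_orthogonally_diagonalized[OF A P PP PAP] le ge by (simp add: A_def)
qed


section \<open>Congruences with the diagonal energy matrix\<close>

definition zeta_mat :: "'a set list \<Rightarrow> real mat" where
  "zeta_mat xs = mat_of_kernel xs (\<lambda>z x. if z \<subseteq> x then 1 else 0)"

lemma zeta_mat_carrier [simp]: "zeta_mat xs \<in> carrier_mat (length xs) (length xs)"
  by (simp add: zeta_mat_def mat_of_kernel_def)

text \<open>Unitriangularity in disguise, which makes it unnecessary to sort the list: let \<open>v\<close> be a nonzero
  kernel vector and \<open>x\<close> a set of largest cardinality in its support. No other set of the support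
  contains \<open>x\<close>, so the row of \<open>x\<close> in the system reads \<open>v x = 0\<close>.\<close>

lemma det_zeta_mat_nonzero:
  assumes xs: "distinct xs" and fin: "\<And>x. x \<in> set xs \<Longrightarrow> finite x"
  shows "det (zeta_mat xs) \<noteq> 0"
proof
  let ?n = "length xs"
  assume "det (zeta_mat xs) = 0"
  then obtain v where v: "v \<in> carrier_vec ?n" "v \<noteq> 0\<^sub>v ?n" and Zv: "zeta_mat xs *\<^sub>v v = 0\<^sub>v ?n"
    using det_0_iff_vec_prod_zero[OF zeta_mat_carrier] by blast
  define I where "I = {i. i < ?n \<and> v $ i \<noteq> 0}"
  have I: "finite I" "I \<noteq> {}" using v by (auto simp: I_def)
  then obtain k where k: "k \<in> I" and max: "\<And>i. i \<in> I \<Longrightarrow> card (xs ! i) \<le> card (xs ! k)"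
    using obtains_MAX[OF I, of "\<lambda>i. card (xs ! i)"] by (metis Max_ge finite_imageI imageI)
  have kn: "k < ?n" using k by (simp add: I_def)
  have "0 = (zeta_mat xs *\<^sub>v v) $ k" using Zv kn by simp
  also have "\<dots> = (\<Sum>i\<in>{0..<?n}. (if xs ! k \<subseteq> xs ! i then 1 else 0) * v $ i)"
    using v kn by (simp add: zeta_mat_def mat_of_kernel_def scalar_prod_def)
  also have "\<dots> = (\<Sum>i\<in>{0..<?n}. if i = k then v $ k else 0)"
  proof (rule sum.cong)
    fix i assume i: "i \<in> {0..<?n}"
    \<comment> \<open>A set of the support that contains \<open>xs ! k\<close> is equal to it, since it has no larger cardinality.\<close>
    have "xs ! k = xs ! i" if "xs ! k \<subseteq> xs ! i" "i \<in> I"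
      using max[OF that(2)] that(1) fin[of "xs ! i"] i by (intro card_seteq) auto
    then show "(if xs ! k \<subseteq> xs ! i then 1 else 0) * v $ i = (if i = k then v $ k else 0)"
      using i kn nth_eq_iff_index_eq[OF xs] by (auto simp: I_def)
  qed simp
  also have "\<dots> = v $ k" using kn by simp
  finally show False using k by (simp add: I_def)
qed

lemma congruence_of_kernel:
  fixes K :: "'b \<Rightarrow> 'b \<Rightarrow> real"
  assumes "distinct xs"
  shows "transpose_mat (mat_of_kernel xs K) * mat_diag (length xs) (\<lambda>i. h (xs ! i)) * mat_of_kernel xs K
    = mat_of_kernel xs (\<lambda>x y. \<Sum>z\<in>set xs. K z x * h z * K z y)"
proof -
  let ?n = "length xs"
  have K: "mat_of_kernel xs K \<in> carrier_mat ?n ?n" by (simp add: mat_of_kernel_def)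
  have sum_xs: "(\<Sum>z\<in>set xs. f z) = (\<Sum>i\<in>{0..<?n}. f (xs ! i))" for f :: "'b \<Rightarrow> real"
    using sum.reindex_bij_betw[OF bij_betw_nth[OF assms refl refl], of f]
    by (simp add: lessThan_atLeast0)
  show ?thesis using K
    by (subst mat_diag_mult_right[of _ ?n])
      (auto intro!: eq_matI simp: mat_of_kernel_def scalar_prod_def sum_xs)
qed

lemma sum_times_indicators:
  assumes "finite A"
  shows "(\<Sum>z\<in>A. (if p z then 1 else 0) * h z * (if q z then 1 else 0)) =
    (\<Sum>z\<in>{z\<in>A. p z \<and> q z}. h z :: real)"
  by (subst sum.inter_filter[OF assms]) (auto intro!: sum.cong)

lemma L_minus_congruence:
  assumes "distinct xs"
  shows "L_minus xs h = transpose_mat (zeta_mat xs) * mat_diag (length xs) (\<lambda>i. h (xs ! i)) * zeta_mat xs"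
proof -
  have "core (set xs) x \<inter> core (set xs) y = {z \<in> set xs. z \<subseteq> x \<and> z \<subseteq> y}" for x y
    by (auto simp: core_def)
  then show ?thesis
    unfolding zeta_mat_def congruence_of_kernel[OF assms] L_minus_def
    by (simp add: energy_def sum_times_indicators)
qed

text \<open>The reverse inclusion order has the transposed zeta matrix.\<close>

lemma L_plus_congruence:
  assumes "distinct xs"
  shows "L_plus xs h = zeta_mat xs * mat_diag (length xs) (\<lambda>i. h (xs ! i)) * transpose_mat (zeta_mat xs)"
proof -
  have "star (set xs) x \<inter> star (set xs) y = {z \<in> set xs. x \<subseteq> z \<and> y \<subseteq> z}" for x y
    by (auto simp: star_def)
  moreover have "transpose_mat (zeta_mat xs) = mat_of_kernel xs (\<lambda>z x. if x \<subseteq> z then 1 else 0)"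
    by (auto simp: zeta_mat_def mat_of_kernel_def intro!: eq_matI)
  moreover have "zeta_mat xs = transpose_mat (transpose_mat (zeta_mat xs))" by simp
  ultimately show ?thesis
    using congruence_of_kernel[OF assms, of "\<lambda>z x. if x \<subseteq> z then 1 else 0" h]
    by (simp add: energy_def sum_times_indicators L_plus_def)
qed

lemma S_mat_diag:
  assumes "distinct xs"
  shows "S_mat xs = mat_diag (length xs) (\<lambda>i. omega (xs ! i))"
  using nth_eq_iff_index_eq[OF assms]
  by (auto simp: S_mat_def mat_of_kernel_def mat_diag_def intro!: eq_matI)

lemma det_S_mat_nonzero:
  assumes "distinct xs"
  shows "det (S_mat xs) \<noteq> 0"
proof -
  let ?S = "S_mat xs" and ?n = "length xs"
  have S: "?S \<in> carrier_mat ?n ?n" by (simp add: S_mat_diag[OF assms])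
  have "omega x * omega x = 1" for x :: "'a set"
    by (simp add: omega_def power_int_mult_distrib[symmetric])
  then have "?S * ?S = 1\<^sub>m ?n" by (simp add: S_mat_diag[OF assms])
  then have "det ?S * det ?S = 1" using det_mult[OF S S] by simp
  then show ?thesis by auto
qed

theorem theorem4:
  fixes G :: "'a set set" and h :: "'a set \<Rightarrow> real" and xs :: "'a set list"
  assumes "simplicial_complex G"
    and "distinct xs" and "set xs = G"
  shows "num_neg_eigenvalues (L_minus xs h) = card {x \<in> G. h x < 0}
       \<and> num_neg_eigenvalues (L_plus xs h) = card {x \<in> G. h x < 0}
       \<and> num_neg_eigenvalues (g_mat xs h) = card {x \<in> G. h x < 0}"
proof -
  let ?n = "length xs" and ?Z = "zeta_mat xs" and ?S = "S_mat xs"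
  let ?D = "mat_diag (length xs) (\<lambda>i. h (xs ! i))"
  have dZ: "det ?Z \<noteq> 0"
    using assms by (intro det_zeta_mat_nonzero) (auto simp: simplicial_complex_def)
  have dZT: "det (transpose_mat ?Z) \<noteq> 0" using dZ by (simp add: det_transpose[of _ ?n])
  have ZT: "transpose_mat ?Z \<in> carrier_mat ?n ?n" by simp
  have S: "?S \<in> carrier_mat ?n ?n" and ST: "transpose_mat ?S = ?S"
    by (auto simp: S_mat_diag[OF assms(2)] mat_diag_def intro!: eq_matI)
  have dSZ: "det (transpose_mat ?Z * ?S) \<noteq> 0"
    using det_mult[OF ZT S] dZT det_S_mat_nonzero[OF assms(2)] by simp
  have g: "g_mat xs h = transpose_mat (transpose_mat ?Z * ?S) * ?D * (transpose_mat ?Z * ?S)"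
    using congruence_compose[OF mat_diag_dim ZT S]
    by (simp add: g_mat_def L_plus_congruence[OF assms(2)] ST)
  have "{x \<in> G. h x < 0} = (!) xs ` {i. i < ?n \<and> h (xs ! i) < 0}"
    using assms(3) by (force simp: in_set_conv_nth)
  moreover have "inj_on ((!) xs) {i. i < ?n \<and> h (xs ! i) < 0}"
    using nth_eq_iff_index_eq[OF assms(2)] by (auto simp: inj_on_def)
  ultimately have count: "card {i. i < ?n \<and> h (xs ! i) < 0} = card {x \<in> G. h x < 0}"
    by (simp add: card_image)
  show ?thesis
    using sylvester_inertia_negative[OF zeta_mat_carrier dZ, of "\<lambda>i. h (xs ! i)"]
      sylvester_inertia_negative[OF ZT dZT, of "\<lambda>i. h (xs ! i)"]
      sylvester_inertia_negative[OF mult_carrier_mat[OF ZT S] dSZ, of "\<lambda>i. h (xs ! i)"]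
    by (simp add: count g L_minus_congruence[OF assms(2)] L_plus_congruence[OF assms(2)])
qed

end
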